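(* Let $A\in\mathbb{R}^{m\times n}$ ($m\le n$) have full row rank $m$, let $b\in\mathbb{R}^m$, $c\in\mathbb{R}^n$, let $(x^*,y^*,s^* )$ be a solution of (PD), and let $\hat\mu>0$. Then there exists a vector of perturbations $\hat\lambda=\hat\lambda(x^*,s^*,\hat\mu)\in\mathbb{R}^n$, $\hat\lambda>0$, such that the perturbed central path with $\lambda=\hat\lambda$ passes through $(x^*,y^*,s^* )$ exactly when $\mu=\hat\mu$; that is, $(x^*,y^*,s^* )$ is the point of the central path of (PD$_{\hat\lambda}$) corresponding to the parameter value $\mu=\hat\mu$.
   Context: Vector inequalities are componentwise; $e$ is the vector of ones; for a vector $v$, the corresponding capital letter denotes $\mathrm{diag}(v)$ ($X=\mathrm{diag}(x)$, $S=\mathrm{diag}(s)$, $\Lambda=\mathrm{diag}(\lambda)$). (PD) is the primal-dual pair of linear programs: minimize $c^Tx$ subject to $Ax=b$, $x\ge 0$; and maximize $b^Ty$ subject to $A^Ty+s=c$, $s\ge0$. A solution of (PD) is a triple $(x^*,y^*,s^* )\in\mathbb{R}^n\times\mathbb{R}^m\times\mathbb{R}^n$ with $x^*$ primal optimal and $(y^*,s^* )$ dual optimal (equivalently $Ax^*=b$, $A^Ty^*+s^*=c$, $x^*_is^*_i=0$ for all $i$, $x^*,s^*\ge 0$). For $\lambda\ge0$, (PD$_\lambda$) is the perturbed pair: minimize $(c+\lambda)^T(x+\lambda)$ subject to $Ax=b$, $x\ge-\lambda$; and maximize $(b+A\lambda)^Ty$ subject to $A^Ty+s=c$, $s\ge-\lambda$.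 The (perturbed) central path of (PD$_\lambda$) is the set of points $(x,y,s)$ that, for some $\mu>0$, solve $$Ax=b,\quad A^Ty+s=c,\quad (X+\Lambda)(S+\Lambda)e=\mu e,\quad (x+\lambda,s+\lambda)>0;$$ the point corresponding to $\mu$ is the unique solution of this system for that $\mu$. *)

theory Defs
  imports "HOL-Analysis.Analysis"
begin

definition primal_feasible :: "real^'n^'m \<Rightarrow> real^'m \<Rightarrow> real^'n \<Rightarrow> bool" where
  "primal_feasible A b x \<longleftrightarrow> A *v x = b \<and> (\<forall>i. 0 \<le> x $ i)"

definition primal_optimal :: "real^'n^'m \<Rightarrow> real^'m \<Rightarrow> real^'n \<Rightarrow> real^'n \<Rightarrow> bool" where
  "primal_optimal A b c x \<longleftrightarrow>
     primal_feasible A b x \<and> (\<forall>x'. primal_feasible A b x' \<longrightarrow> c \<bullet> x \<le> c \<bullet> x')"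

definition dual_feasible :: "real^'n^'m \<Rightarrow> real^'n \<Rightarrow> real^'m \<Rightarrow> real^'n \<Rightarrow> bool" where
  "dual_feasible A c y s \<longleftrightarrow> transpose A *v y + s = c \<and> (\<forall>i. 0 \<le> s $ i)"

definition dual_optimal ::
    "real^'n^'m \<Rightarrow> real^'m \<Rightarrow> real^'n \<Rightarrow> real^'m \<Rightarrow> real^'n \<Rightarrow> bool" where
  "dual_optimal A b c y s \<longleftrightarrow>
     dual_feasible A c y s \<and> (\<forall>y' s'. dual_feasible A c y' s' \<longrightarrow> b \<bullet> y' \<le> b \<bullet> y)"

definition pd_solution ::
    "real^'n^'m \<Rightarrow> real^'m \<Rightarrow> real^'n \<Rightarrow> real^'n \<Rightarrow> real^'m \<Rightarrow> real^'n \<Rightarrow> bool" where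
  "pd_solution A b c x y s \<longleftrightarrow> primal_optimal A b c x \<and> dual_optimal A b c y s"

definition diag :: "real^'n \<Rightarrow> real^'n^'n" where
  "diag v = (\<chi> i j. if i = j then v $ i else 0)"

(* Positivity is stated componentwise: the library order < on vectors is only
   "\<le> and not \<ge>", so 0 < v would not say that every entry is positive. *)
definition central_path_system ::
    "real^'n^'m \<Rightarrow> real^'m \<Rightarrow> real^'n \<Rightarrow> real^'n \<Rightarrow> real \<Rightarrow>
     real^'n \<Rightarrow> real^'m \<Rightarrow> real^'n \<Rightarrow> bool" where
  "central_path_system A b c lam mu x y s \<longleftrightarrow>
     A *v x = b \<and>
     transpose A *v y + s = c \<and>
     ((diag x + diag lam) ** (diag s + diag lam)) *v 1 = mu *\<^sub>R 1 \<and>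
     (\<forall>i. 0 < (x + lam) $ i) \<and> (\<forall>i. 0 < (s + lam) $ i)"

definition central_path_point ::
    "real^'n^'m \<Rightarrow> real^'m \<Rightarrow> real^'n \<Rightarrow> real^'n \<Rightarrow> real \<Rightarrow>
     real^'n \<Rightarrow> real^'m \<Rightarrow> real^'n \<Rightarrow> bool" where
  "central_path_point A b c lam mu x y s \<longleftrightarrow>
     central_path_system A b c lam mu x y s \<and>
     (\<forall>x' y' s'. central_path_system A b c lam mu x' y' s' \<longrightarrow> x' = x \<and> y' = y \<and> s' = s)"

end

theory Submission imports Defs begin

text \<open>
  Coordinate by coordinate, the equation \<open>(x\<^sub>i + \<lambda>\<^sub>i) (s\<^sub>i + \<lambda>\<^sub>i) = \<mu>\<close> is a quadratic in \<open>\<lambda>\<^sub>i\<close>, and its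
  larger root \<open>(sqrt ((x\<^sub>i - s\<^sub>i)\<^sup>2 + 4 \<mu>) - (x\<^sub>i + s\<^sub>i)) / 2\<close> makes both factors positive whenever \<open>\<mu> > 0\<close>. The
  root itself is positive as soon as \<open>x\<^sub>i, s\<^sub>i \<ge> 0\<close> and \<open>x\<^sub>i s\<^sub>i < \<mu>\<close>, so at a solution of the linear
  programs everything rests on complementarity, \<open>x\<^sub>i s\<^sub>i = 0\<close>.

  Since solutions are defined by optimality, complementarity is strong duality for linear
  programs. At a primal optimum \<open>x\<close> no direction \<open>d\<close> with \<open>A d = 0\<close> that points into the
  orthant at the active constraints can decrease the cost. By Farkas' lemma (finitely generated cones
  are closed, hence can be separated from points outside) the cost vector is then
  \<open>A\<^sup>T y + s\<close> with \<open>s \<ge> 0\<close> vanishing off the active set. This dual point has no duality gap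
  with \<open>x\<close>, so neither does any dual optimum (lemma \<open>pd_solution_complementary\<close>).

  That the central path has no second point for the same \<open>\<mu>\<close> is a monotonicity argument. The
  differences of two points in \<open>x\<close> and in \<open>s\<close> are orthogonal, one lying in the kernel of \<open>A\<close> and the
  other in the range of \<open>A\<^sup>T\<close>; but as \<open>u \<mapsto> \<mu> / u\<close> is strictly decreasing on the positive reals,
  their coordinatewise products are negative wherever the points differ. The full rank of \<open>A\<close> finally
  determines \<open>y\<close>.
\<close>

section \<open>Farkas' lemma and complementary slackness\<close>

text \<open>
  The hyperplane that separates a point from the closed cone can be taken through the origin: a
  functional that is bounded below on a cone is nonnegative on it.
\<close>

lemma farkas_convex_cone_hull:
  fixes S :: "'a::euclidean_space set"
  assumes "finite S" and dual: "\<And>d. (\<And>a. a \<in> S \<Longrightarrow> 0 \<le> d \<bullet> a) \<Longrightarrow> 0 \<le> d \<bullet> c"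
  shows "c \<in> convex_cone hull S"
proof (rule ccontr)
  assume "c \<notin> convex_cone hull S"
  with separating_hyperplane_closed_point[OF convex_convex_cone_hull closed_convex_cone_hull[OF \<open>finite S\<close>]]
  obtain d \<beta> where d: "d \<bullet> c < \<beta>" and above: "\<And>z. z \<in> convex_cone hull S \<Longrightarrow> \<beta> < d \<bullet> z"
    by blast
  have "\<beta> < 0"
    using above[OF convex_cone_hull_contains_0] by simp
  have "0 \<le> d \<bullet> a" if "a \<in> S" for a
  proof (rule ccontr)
    assume neg: "\<not> 0 \<le> d \<bullet> a"
    \<comment> \<open>The multiple of \<open>a\<close> on which the functional takes exactly the value \<open>\<beta>\<close>.\<close>
    have "(\<beta> / (d \<bullet> a)) *\<^sub>R a \<in> convex_cone hull S"
      using that neg \<open>\<beta> < 0\<close> by (intro convex_cone_hull_mul hull_inc) (auto simp: divide_nonpos_nonpos)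
    from above[OF this] show False
      using neg by auto
  qed
  then have "0 \<le> d \<bullet> c"
    by (rule dual)
  with d \<open>\<beta> < 0\<close> show False
    by simp
qed

lemma inner_transpose_matrix_vector:
  fixes A :: "real^'n^'m"
  shows "(transpose A *v y) \<bullet> x = y \<bullet> (A *v x)"
  by (simp add: dot_lmul_matrix)

text \<open>
  An arbitrarily short step along \<open>d\<close> stays feasible, because the coordinates that could become
  negative have a positive amount of slack.
\<close>

lemma primal_optimal_feasible_direction:
  assumes opt: "primal_optimal A b c x"
    and "A *v d = 0" and active: "\<And>i. x $ i = 0 \<Longrightarrow> 0 \<le> d $ i"
  shows "0 \<le> c \<bullet> d"
proof -
  have feas: "A *v x = b" "\<And>i. 0 \<le> x $ i"
    using opt by (auto simp: primal_optimal_def primal_feasible_def)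
  have "\<forall>\<^sub>F t in at_right 0. 0 \<le> x $ i + t * d $ i" for i
  proof (cases "x $ i = 0")
    case True
    then show ?thesis
      using active[of i] by (auto intro!: eventually_mono[OF eventually_at_right_less])
  next
    case False
    have "((\<lambda>t. x $ i + t * d $ i) \<longlongrightarrow> x $ i + 0 * d $ i) (at_right 0)"
      by (intro tendsto_intros)
    moreover have "0 < x $ i + 0 * d $ i"
      using False feas(2)[of i] by simp
    ultimately have "\<forall>\<^sub>F t in at_right 0. 0 < x $ i + t * d $ i"
      by (rule order_tendstoD)
    then show ?thesis
      by (rule eventually_mono) simp
  qed
  then have "\<forall>\<^sub>F t in at_right (0::real). \<forall>i. 0 \<le> x $ i + t * d $ i"
    by (intro eventually_all_finite) auto
  then have "\<forall>\<^sub>F t in at_right (0::real). 0 < t \<and> (\<forall>i. 0 \<le> x $ i + t * d $ i)"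
    by (intro eventually_conj eventually_at_right_less)
  then obtain t :: real where t: "0 < t" "\<And>i. 0 \<le> x $ i + t * d $ i"
    using eventually_happens[of _ "at_right (0::real)"] by (auto simp: trivial_limit_at_right_real)
  have "primal_feasible A b (x + t *\<^sub>R d)"
    using t(2) feas(1) \<open>A *v d = 0\<close>
    by (simp add: primal_feasible_def matrix_vector_right_distrib matrix_vector_mult_scaleR)
  then have "c \<bullet> x \<le> c \<bullet> (x + t *\<^sub>R d)"
    using opt by (simp add: primal_optimal_def)
  then show ?thesis
    using t(1) by (simp add: inner_add_right zero_le_mult_iff)
qed

text \<open>
  By the previous lemma the cost vector satisfies the hypothesis of Farkas' lemma for the rows of \<open>A\<close>,
  their negatives and the unit vectors of the active constraints. Only these unit vectors contribute
  to \<open>s\<close>, which makes it complementary to \<open>x\<close>.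
\<close>

lemma primal_optimal_imp_dual_certificate:
  assumes opt: "primal_optimal A b c x"
  obtains y s where "dual_feasible A c y s" and "\<And>i. x $ i * s $ i = 0"
proof -
  \<comment> \<open>Both signs of each row are generators, so their cone is the whole row space of \<open>A\<close>.\<close>
  define R where "R = range (\<lambda>j. transpose A *v axis j 1)"
  define E where "E = (\<lambda>i. axis i (1::real)) ` {i. x $ i = 0}"
  define K where "K = {v. \<exists>y s. v = transpose A *v y + s \<and> (\<forall>i. 0 \<le> s $ i \<and> x $ i * s $ i = 0)}"
  have "c \<in> convex_cone hull (R \<union> uminus ` R \<union> E)"
  proof (rule farkas_convex_cone_hull)
    show "finite (R \<union> uminus ` R \<union> E)"
      by (simp add: R_def E_def)
  next
    fix d
    assume d: "\<And>a. a \<in> R \<union> uminus ` R \<union> E \<Longrightarrow> 0 \<le> d \<bullet> a"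
    have "(A *v d) $ j = 0" for j
    proof -
      have "d \<bullet> (transpose A *v axis j 1) = (A *v d) $ j"
        by (simp only: inner_commute[of d] inner_transpose_matrix_vector inner_axis' inner_real_def mult_1_left)
      moreover have "0 \<le> d \<bullet> (transpose A *v axis j 1)" "0 \<le> d \<bullet> - (transpose A *v axis j 1)"
        by (auto intro!: d simp: R_def simp del: transpose_matrix_vector inner_minus_right)
      ultimately show ?thesis
        by simp
    qed
    then have "A *v d = 0"
      by (simp add: vec_eq_iff)
    moreover have "0 \<le> d $ i" if "x $ i = 0" for i
      using d[of "axis i 1"] that by (auto simp: E_def inner_axis)
    ultimately have "0 \<le> c \<bullet> d"
      by (rule primal_optimal_feasible_direction[OF opt])
    then show "0 \<le> d \<bullet> c"
      by (simp add: inner_commute)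
  qed
  also have "convex_cone hull (R \<union> uminus ` R \<union> E) \<subseteq> K"
  proof (rule hull_minimal)
    have row: "transpose A *v y \<in> K" for y
      unfolding K_def by (rule CollectI, rule exI[of _ y], rule exI[of _ 0]) simp
    have "uminus ` R \<subseteq> K"
    proof -
      have "- (transpose A *v axis j 1) = transpose A *v (- axis j 1)" for j
        by (metis add.right_inverse add_eq_0_iff matrix_vector_mult_0_right matrix_vector_right_distrib)
      then show ?thesis
        using row by (auto simp: R_def simp del: transpose_matrix_vector)
    qed
    moreover have "axis i 1 \<in> K" if "x $ i = 0" for i
      unfolding K_def using that
      by (intro CollectI exI[of _ 0] exI[of _ "axis i 1"]) (auto simp: axis_def)
    ultimately show "R \<union> uminus ` R \<union> E \<subseteq> K"
      using row by (auto simp: R_def E_def simp del: transpose_matrix_vector)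
    have "0 \<in> K"
      using row[of 0] by simp
    moreover have "v + w \<in> K" if vw: "v \<in> K" "w \<in> K" for v w
    proof -
      obtain y s y' s' where
        "v = transpose A *v y + s" "\<forall>i. 0 \<le> s $ i \<and> x $ i * s $ i = 0"
        "w = transpose A *v y' + s'" "\<forall>i. 0 \<le> s' $ i \<and> x $ i * s' $ i = 0"
        using vw unfolding K_def by blast
      then show ?thesis
        unfolding K_def
        by (intro CollectI exI[of _ "y + y'"] exI[of _ "s + s'"])
          (auto simp: matrix_vector_right_distrib simp del: transpose_matrix_vector, metis add_0)
    qed
    moreover have "r *\<^sub>R v \<in> K" if "v \<in> K" "0 \<le> r" for v r
    proof -
      obtain y s where "v = transpose A *v y + s" "\<forall>i. 0 \<le> s $ i \<and> x $ i * s $ i = 0"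
        using \<open>v \<in> K\<close> unfolding K_def by blast
      then show ?thesis
        unfolding K_def using \<open>0 \<le> r\<close>
        by (intro CollectI exI[of _ "r *\<^sub>R y"] exI[of _ "r *\<^sub>R s"])
          (auto simp: matrix_vector_mult_scaleR scaleR_add_right simp del: transpose_matrix_vector)
    qed
    ultimately show "convex_cone K"
      by (simp add: convex_cone_iff)
  qed
  finally show thesis
    using that by (auto simp: K_def dual_feasible_def)
qed

lemma duality_gap:
  assumes "primal_feasible A b x" and "dual_feasible A c y s"
  shows "c \<bullet> x - b \<bullet> y = (\<Sum>i\<in>UNIV. x $ i * s $ i)"
proof -
  have "c \<bullet> x = y \<bullet> (A *v x) + s \<bullet> x"
    using assms(2) inner_transpose_matrix_vector[of A y x]
    by (auto simp: dual_feasible_def inner_add_left)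
  also have "A *v x = b"
    using assms(1) by (simp add: primal_feasible_def)
  finally show ?thesis
    by (simp add: inner_commute[of b] inner_vec_def[of s] mult.commute)
qed

text \<open>
  The complementary dual point closes the duality gap, a dual optimum does at least as well, and a
  vanishing sum of nonnegative products forces each product to vanish.
\<close>

lemma pd_solution_complementary:
  assumes sol: "pd_solution A b c x y s"
  shows "x $ i * s $ i = 0"
proof -
  have P: "primal_optimal A b c x" "primal_feasible A b x"
    and D: "dual_optimal A b c y s" "dual_feasible A c y s"
    using sol by (auto simp: pd_solution_def primal_optimal_def dual_optimal_def)
  obtain y' s' where cert: "dual_feasible A c y' s'" "\<And>i. x $ i * s' $ i = 0"
    using primal_optimal_imp_dual_certificate[OF P(1)] by metis
  have "c \<bullet> x = b \<bullet> y'"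
    using duality_gap[OF P(2) cert(1)] cert(2) by simp
  moreover have "b \<bullet> y' \<le> b \<bullet> y"
    using D(1) cert(1) by (auto simp: dual_optimal_def)
  ultimately have le: "(\<Sum>i\<in>UNIV. x $ i * s $ i) \<le> 0"
    using duality_gap[OF P(2) D(2)] by simp
  have nonneg: "0 \<le> x $ i * s $ i" for i
    using P(2) D(2) by (simp add: primal_feasible_def dual_feasible_def)
  then have "(\<Sum>i\<in>UNIV. x $ i * s $ i) = 0"
    using le by (intro antisym sum_nonneg)
  then show ?thesis
    using nonneg by (simp add: sum_nonneg_eq_0_iff)
qed

section \<open>The central path\<close>

lemma diag_add_mult_one:
  fixes x s lam :: "real^'n"
  shows "(((diag x + diag lam) ** (diag s + diag lam)) *v 1) $ i = (x $ i + lam $ i) * (s $ i + lam $ i)"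
proof -
  have sum: "diag v + diag w = diag (v + w)" for v w :: "real^'n"
    by (simp add: diag_def vec_eq_iff)
  have mult: "(diag v *v w) $ j = v $ j * w $ j" for v w :: "real^'n" and j
  proof -
    have "(diag v *v w) $ j = (\<Sum>k\<in>UNIV. if j = k then v $ j * w $ k else 0)"
      unfolding diag_def matrix_vector_mult_def vec_lambda_beta by (intro sum.cong) simp_all
    then show ?thesis
      by simp
  qed
  show ?thesis
    by (simp only: sum mult matrix_vector_mul_assoc[symmetric] vector_add_component one_index mult_1_right)
qed

lemma central_path_system_iff:
  "central_path_system A b c lam mu x y s \<longleftrightarrow>
     A *v x = b \<and> transpose A *v y + s = c \<and>
     (\<forall>i. (x $ i + lam $ i) * (s $ i + lam $ i) = mu \<and> 0 < x $ i + lam $ i \<and> 0 < s $ i + lam $ i)"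
  unfolding central_path_system_def by (auto simp: vec_eq_iff diag_add_mult_one)

text \<open>
  Moving along a branch of a hyperbola trades one coordinate for the other. The equality case is what
  makes a point of the central path unique.
\<close>

lemma hyperbola_antimono:
  fixes u v u' v' :: real
  assumes "u * v = u' * v'" and "0 < u" "0 < v" "0 < u'" "0 < v'"
  shows "(u - u') * (v - v') \<le> 0" and "(u - u') * (v - v') = 0 \<Longrightarrow> u = u' \<and> v = v'"
proof -
  \<comment> \<open>Both claims can be read off from \<open>u (v - v') = - v' (u - u')\<close>.\<close>
  have eq: "u * (v - v') = - (v' * (u - u'))"
    using assms(1) by (simp add: algebra_simps)
  have "u * ((u - u') * (v - v')) = (u - u') * (u * (v - v'))"
    by (simp add: algebra_simps)
  also have "\<dots> = - (v' * (u - u')\<^sup>2)"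
    by (simp add: eq power2_eq_square)
  finally have key: "u * ((u - u') * (v - v')) = - (v' * (u - u')\<^sup>2)" .
  then have "u * ((u - u') * (v - v')) \<le> 0"
    using \<open>0 < v'\<close> by simp
  then show "(u - u') * (v - v') \<le> 0"
    using \<open>0 < u\<close> by (simp only: mult_le_0_iff) linarith
  assume "(u - u') * (v - v') = 0"
  with key \<open>0 < v'\<close> have "u = u'"
    by simp
  with eq \<open>0 < u\<close> show "u = u' \<and> v = v'"
    by simp
qed

text \<open>
  The sum over the coordinates of \<open>(x' - x) (s' - s)\<close> vanishes by orthogonality, while each term is
  nonpositive because both points lie on the same hyperbolas; hence every term is zero.
\<close>

lemma central_path_system_unique:
  fixes A :: "real^'n^'m"
  assumes rank: "rank A = CARD('m)"
    and "central_path_system A b c lam mu x y s" and "central_path_system A b c lam mu x' y' s'"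
  shows "x' = x \<and> y' = y \<and> s' = s"
proof -
  have primal: "A *v x = b" "A *v x' = b"
    and dual: "transpose A *v y + s = c" "transpose A *v y' + s' = c"
    and pos: "\<And>i. 0 < x $ i + lam $ i" "\<And>i. 0 < s $ i + lam $ i"
      "\<And>i. 0 < x' $ i + lam $ i" "\<And>i. 0 < s' $ i + lam $ i"
    using assms(2,3) unfolding central_path_system_iff by blast+
  have centred: "(x' $ i + lam $ i) * (s' $ i + lam $ i) = (x $ i + lam $ i) * (s $ i + lam $ i)" for i
    using assms(2,3) unfolding central_path_system_iff by metis
  have "s' - s = transpose A *v y - transpose A *v y'"
    using trans[OF dual(1) dual(2)[symmetric]] by (simp only: diff_eq_eq diff_add_eq eq_diff_eq add.commute)
  then have "s' - s = transpose A *v (y - y')"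
    by (simp only: matrix_vector_mult_diff_distrib)
  then have "(s' - s) \<bullet> (x' - x) = (y - y') \<bullet> (A *v (x' - x))"
    by (simp only: inner_transpose_matrix_vector)
  also have "A *v (x' - x) = 0"
    using primal by (simp add: matrix_vector_mult_diff_distrib)
  finally have orth: "(\<Sum>i\<in>UNIV. (x' $ i - x $ i) * (s' $ i - s $ i)) = 0"
    by (simp add: inner_vec_def mult.commute)
  have nonpos: "(x' $ i - x $ i) * (s' $ i - s $ i) \<le> 0"
    and strict: "(x' $ i - x $ i) * (s' $ i - s $ i) = 0 \<Longrightarrow> x' $ i = x $ i \<and> s' $ i = s $ i" for i
    using hyperbola_antimono[OF centred[of i] pos(3,4,1,2)]
    by (simp_all only: add_diff_cancel_right add_right_cancel)
  have "- ((x' $ i - x $ i) * (s' $ i - s $ i)) = 0" for i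
  proof (rule sum_nonneg_0[of UNIV "\<lambda>i. - ((x' $ i - x $ i) * (s' $ i - s $ i))"])
    show "(\<Sum>i\<in>UNIV. - ((x' $ i - x $ i) * (s' $ i - s $ i))) = 0"
      by (simp only: sum_negf orth minus_zero)
  qed (simp_all only: neg_0_le_iff_le nonpos finite UNIV_I)
  then have "x' $ i = x $ i \<and> s' $ i = s $ i" for i
    by (intro strict) (simp only: neg_equal_0_iff_equal)
  then have xs: "x' = x" "s' = s"
    by (simp_all add: vec_eq_iff)
  then have "transpose A *v y' = transpose A *v y"
    using dual by (metis add_right_cancel)
  moreover have "inj ((*v) (transpose A))"
    using rank by (simp only: full_rank_injective[symmetric] rank_transpose)
  ultimately have "y' = y"
    by (metis injD)
  with xs show ?thesis
    by simp
qed

section \<open>The perturbation\<close>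

text \<open>The larger root \<open>l\<close> of \<open>(a + l) (b + l) = mu\<close>.\<close>

definition perturbation :: "real \<Rightarrow> real \<Rightarrow> real \<Rightarrow> real" where
  "perturbation a b mu = (sqrt ((a - b)\<^sup>2 + 4 * mu) - (a + b)) / 2"

lemma perturbation_product:
  assumes "0 < mu"
  shows "(a + perturbation a b mu) * (b + perturbation a b mu) = mu"
    and "0 < a + perturbation a b mu" and "0 < b + perturbation a b mu"
proof -
  define r where "r = sqrt ((a - b)\<^sup>2 + 4 * mu)"
  have shift: "a + perturbation a b mu = (r + (a - b)) / 2" "b + perturbation a b mu = (r - (a - b)) / 2"
    by (simp_all add: perturbation_def r_def field_simps)
  have "r\<^sup>2 = (a - b)\<^sup>2 + 4 * mu"
    using assms by (simp add: r_def)
  then show "(a + perturbation a b mu) * (b + perturbation a b mu) = mu"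
    unfolding shift by (simp add: power2_eq_square field_simps)
  have "\<bar>a - b\<bar> < r"
    unfolding r_def using assms by (intro real_less_rsqrt) simp
  then show "0 < a + perturbation a b mu" "0 < b + perturbation a b mu"
    unfolding shift by auto
qed

lemma perturbation_pos:
  assumes "0 \<le> a" "0 \<le> b" "a * b < mu"
  shows "0 < perturbation a b mu"
proof -
  have "a + b < sqrt ((a - b)\<^sup>2 + 4 * mu)"
    using assms by (intro real_less_rsqrt) (simp add: power2_eq_square algebra_simps)
  then show ?thesis
    by (simp add: perturbation_def)
qed

theorem theorem1:
  "\<exists>lam :: real^'n \<Rightarrow> real^'n \<Rightarrow> real \<Rightarrow> real^'n.
     \<forall>(A :: real^'n^'m) (b :: real^'m) (c :: real^'n) (x :: real^'n) (y :: real^'m) (s :: real^'n)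
        (muhat :: real).
       CARD('m) \<le> CARD('n) \<and> rank A = CARD('m) \<and> pd_solution A b c x y s \<and> 0 < muhat \<longrightarrow>
         (\<forall>i. 0 < lam x s muhat $ i) \<and>
         (\<forall>mu>0. central_path_system A b c (lam x s muhat) mu x y s \<longleftrightarrow> mu = muhat) \<and>
         central_path_point A b c (lam x s muhat) muhat x y s"
proof (intro exI[of _ "\<lambda>x s mu. \<chi> i. perturbation (x $ i) (s $ i) mu"] allI impI, elim conjE)
  fix A :: "real^'n^'m" and b :: "real^'m" and c :: "real^'n" and x :: "real^'n" and y :: "real^'m"
    and s :: "real^'n" and muhat :: real
  assume rank: "rank A = CARD('m)" and sol: "pd_solution A b c x y s" and mu: "0 < muhat"
  define lam :: "real^'n" where "lam = (\<chi> i. perturbation (x $ i) (s $ i) muhat)"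
  have P: "primal_feasible A b x" and D: "dual_feasible A c y s"
    using sol by (auto simp: pd_solution_def primal_optimal_def dual_optimal_def)
  have "0 < lam $ i" for i
    using P D mu pd_solution_complementary[OF sol, of i]
    unfolding lam_def primal_feasible_def dual_feasible_def by (auto intro!: perturbation_pos)
  moreover have iff: "central_path_system A b c lam mu x y s \<longleftrightarrow> mu = muhat" for mu
    using P D perturbation_product[OF mu]
    by (auto simp: central_path_system_iff lam_def primal_feasible_def dual_feasible_def)
  moreover have "central_path_point A b c lam muhat x y s"
    using iff[of muhat] central_path_system_unique[OF rank]
    unfolding central_path_point_def by blast
  ultimately show "(\<forall>i. 0 < (\<chi> i. perturbation (x $ i) (s $ i) muhat) $ i) \<and>
      (\<forall>mu>0. central_path_system A b c (\<chi> i. perturbation (x $ i) (s $ i) muhat) mu x y s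
         \<longleftrightarrow> mu = muhat) \<and>
      central_path_point A b c (\<chi> i. perturbation (x $ i) (s $ i) muhat) muhat x y s"
    unfolding lam_def by blast
qed

end
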